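(* Let $\mathscr{C}$ be the incidence structure whose points are the twelve major triads in $\mathbb{Z}/12$, whose lines are the twelve minor triads in $\mathbb{Z}/12$, and in which a major triad and a minor triad are incident if and only if they have exactly two pitch classes in common. Then $\mathscr{C}$ is a self-dual combinatorial configuration of type $\{12_3\}$, isomorphic to the configuration D222 of Daublebsky von Sterneck, and it can be realized geometrically in $\mathbb{R}^2$: there exist twelve distinct points $p_M\in\mathbb{R}^2$, one for each major triad $M$, and twelve distinct straight lines $\ell_m\subset\mathbb{R}^2$, one for each minor triad $m$, such that $p_M\in\ell_m$ if and only if $M$ and $m$ are incident in $\mathscr{C}$. In particular, exactly three of the points lie on each line, exactly three of the lines pass through each point, and the $36$ incidences between the points and the lines are exactly the edges of the Levi graph of $\mathscr{C}$.
   Context: Pitch classes are identified with elements of $\mathbb{Z}/12$ ($C=0$, $C_\sharp=D_\flat=1,\dots,B=11$). For $x\in\mathbb{Z}/12$ the major triad with root $x$ is the set $\{x,x+4,x+7\}$ and the minor triad with root $x$ is the set $\{x,x+3,x+7\}$. An incidence structure consists of disjoint finite sets $\mathbb{P}$ (points) and $\mathbb{L}$ (lines) and an incidence relation between them such that two distinct lines are both incident with at most one common point and two distinct points are both incident with at most one common line. A combinatorial configuration of type $\{n_k\}$ is an incidence structure with $n$ points and $n$ lines such that every line is incident with exactly $k$ points and every point is incident with exactly $k$ lines. An isomorphism of configurations is a pair of bijections (points to points, lines to lines) preserving and reflecting incidence. A configuration is self-dual if it is isomorphic to the configuration obtained from it by interchanging the roles of points and lines. The Levi graph of a configuration is the bipartite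 graph with one white vertex for each point and one black vertex for each line, joined by an edge exactly when the point and the line are incident. D222 is the name, in Daublebsky von Sterneck's 1895 list of the configurations of type $\{12_3\}$, of the isomorphism class of the cyclic configuration with points $0,1,\dots,11\in\mathbb{Z}/12$ and with lines the twelve sets $\{i,\,i+1,\,i+4\}$, $i\in\mathbb{Z}/12$ (incidence being membership). *)

theory Defs
  imports "HOL-Analysis.Analysis" "HOL-Library.Numeral_Type"
begin

text \<open>The numeral type 12 is the ring of integers modulo 12; its arithmetic is modular.\<close>

type_synonym pitch_class = 12

definition major_triad :: "pitch_class \<Rightarrow> pitch_class set" where
  "major_triad x = {x, x + 4, x + 7}"

definition minor_triad :: "pitch_class \<Rightarrow> pitch_class set" where
  "minor_triad x = {x, x + 3, x + 7}"

definition major_triads :: "pitch_class set set" where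
  "major_triads = range major_triad"

definition minor_triads :: "pitch_class set set" where
  "minor_triads = range minor_triad"

text \<open>Points and lines are taken from one common type, so that their disjointness is a genuine
  requirement and the vertices of the Levi graph are the points and lines themselves.\<close>

record 'a incidence_data =
  points :: "'a set"
  lines :: "'a set"
  incidences :: "('a \<times> 'a) set"

definition incidence_structure :: "'a incidence_data \<Rightarrow> bool" where
  "incidence_structure S \<longleftrightarrow>
     finite (points S) \<and> finite (lines S) \<and> points S \<inter> lines S = {} \<and>
     incidences S \<subseteq> points S \<times> lines S \<and>
     (\<forall>l\<in>lines S. \<forall>l'\<in>lines S. l \<noteq> l' \<longrightarrow>
        card {q \<in> points S. (q, l) \<in> incidences S \<and> (q, l') \<in> incidences S} \<le> 1) \<and>
     (\<forall>q\<in>points S. \<forall>q'\<in>points S. q \<noteq> q' \<longrightarrow>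
        card {l \<in> lines S. (q, l) \<in> incidences S \<and> (q', l) \<in> incidences S} \<le> 1)"

definition configuration :: "nat \<Rightarrow> nat \<Rightarrow> 'a incidence_data \<Rightarrow> bool" where
  "configuration n k S \<longleftrightarrow>
     incidence_structure S \<and> card (points S) = n \<and> card (lines S) = n \<and>
     (\<forall>l\<in>lines S. card {q \<in> points S. (q, l) \<in> incidences S} = k) \<and>
     (\<forall>q\<in>points S. card {l \<in> lines S. (q, l) \<in> incidences S} = k)"

definition isomorphism ::
    "('a \<Rightarrow> 'b) \<Rightarrow> ('a \<Rightarrow> 'b) \<Rightarrow> 'a incidence_data \<Rightarrow> 'b incidence_data \<Rightarrow> bool" where
  "isomorphism f g S T \<longleftrightarrow>
     bij_betw f (points S) (points T) \<and> bij_betw g (lines S) (lines T) \<and>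
     (\<forall>q\<in>points S. \<forall>l\<in>lines S. (q, l) \<in> incidences S \<longleftrightarrow> (f q, g l) \<in> incidences T)"

definition isomorphic :: "'a incidence_data \<Rightarrow> 'b incidence_data \<Rightarrow> bool" where
  "isomorphic S T \<longleftrightarrow> (\<exists>f g. isomorphism f g S T)"

definition dual_structure :: "'a incidence_data \<Rightarrow> 'a incidence_data" where
  "dual_structure S =
     \<lparr>points = lines S, lines = points S, incidences = (incidences S)\<inverse>\<rparr>"

definition self_dual :: "'a incidence_data \<Rightarrow> bool" where
  "self_dual S \<longleftrightarrow> isomorphic S (dual_structure S)"

record 'a coloured_graph =
  white_vertices :: "'a set"
  black_vertices :: "'a set"
  edges :: "'a set set"

definition levi_graph :: "'a incidence_data \<Rightarrow> 'a coloured_graph" where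
  "levi_graph S =
     \<lparr>white_vertices = points S, black_vertices = lines S,
      edges = {{q, l} | q l. (q, l) \<in> incidences S}\<rparr>"

definition triad_structure :: "pitch_class set incidence_data" where
  "triad_structure =
     \<lparr>points = major_triads, lines = minor_triads,
      incidences = {(M, m). M \<in> major_triads \<and> m \<in> minor_triads \<and> card (M \<inter> m) = 2}\<rparr>"

text \<open>The sum type keeps the points (residues) disjoint from the lines (sets of residues).\<close>

definition D222_lines :: "12 set set" where
  "D222_lines = range (\<lambda>i. {i, i + 1, i + 4})"

definition D222 :: "(12 + 12 set) incidence_data" where
  "D222 =
     \<lparr>points = range Inl, lines = Inr ` D222_lines,
      incidences = {(Inl x, Inr B) | x B. B \<in> D222_lines \<and> x \<in> B}\<rparr>"

definition straight_line :: "(real^2) set \<Rightarrow> bool" where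
  "straight_line K \<longleftrightarrow> (\<exists>a b. a \<noteq> b \<and> K = affine hull {a, b})"

definition geometric_realization ::
    "'a incidence_data \<Rightarrow> ('a \<Rightarrow> real^2) \<Rightarrow> ('a \<Rightarrow> (real^2) set) \<Rightarrow> bool" where
  "geometric_realization S p L \<longleftrightarrow>
     inj_on p (points S) \<and> inj_on L (lines S) \<and> (\<forall>l\<in>lines S. straight_line (L l)) \<and>
     (\<forall>q\<in>points S. \<forall>l\<in>lines S. p q \<in> L l \<longleftrightarrow> (q, l) \<in> incidences S)"

end

theory Submission
  imports Defs
begin

text \<open>The triads with major root \<open>x\<close> and minor root \<open>y\<close> are incident iff \<open>y - x\<close> lies in
  \<open>{0, 4, 9}\<close>, whose six nonzero differences are distinct modulo 12; this gives a cyclic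
  configuration. An affine substitution modulo 12 turns \<open>{0, 4, 9}\<close> into the difference set
  \<open>{0, 1, 4}\<close> of D222. Explicit integer points realize D222; that the points and the lines are
  distinct follows from the incidences, because distinct points lie on at most one common line.\<close>

section \<open>Arithmetic modulo 12\<close>

lemma UNIV_12: "(UNIV :: 12 set) = {0, 1, 2, 3, 4, 5, 6, 7, 8, 9, 10, 11}"
proof -
  have "z \<in> {0, 1, 2, 3, 4, 5, 6, 7, 8, 9, 10, 11}" for z :: 12
  proof (cases z rule: bit0_cases)
    case (of_int n)
    then have "n \<in> {0, 1, 2, 3, 4, 5, 6, 7, 8, 9, 10, 11}"
      by (simp, presburger)
    then show ?thesis
      using of_int by auto
  qed
  then show ?thesis
    by blast
qed

text \<open>Turns a quantifier over residues into twelve closed instances that the simplifier can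
  decide.\<close>

lemma all_12:
  "(\<forall>x::12. P x) \<longleftrightarrow> P 0 \<and> P 1 \<and> P 2 \<and> P 3 \<and> P 4 \<and> P 5 \<and> P 6 \<and> P 7 \<and> P 8 \<and> P 9 \<and> P 10 \<and> P 11"
proof -
  have "(\<forall>x::12. P x) \<longleftrightarrow> (\<forall>x\<in>UNIV. P x)"
    by simp
  then show ?thesis
    unfolding UNIV_12 by simp
qed

text \<open>Since \<open>49 = 7 * 7\<close>, multiplication by 7 is its own inverse modulo 12; both
  bijections onto D222 rely on this.\<close>

lemma mult_49: "49 * x = (x :: 12)"
proof -
  have "49 = (1 :: 12)"
    by simp
  then show ?thesis
    by (simp only: mult_1)
qed

text \<open>If \<open>x + S = y + S\<close>, translation by \<open>x - y\<close> maps
  \<open>S\<close> into itself. A set without nonzero translation symmetry therefore has pairwise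
  distinct translates.\<close>

lemma inj_translates:
  fixes S :: "'a::ab_group_add set"
  assumes "\<And>d. \<forall>s\<in>S. d + s \<in> S \<Longrightarrow> d = 0"
  shows "inj (\<lambda>x. (+) x ` S)"
proof (rule injI)
  fix x y
  assume eq: "(+) x ` S = (+) y ` S"
  have "x - y + s \<in> S" if "s \<in> S" for s
  proof -
    have "x + s \<in> (+) y ` S"
      using that unfolding eq[symmetric] by (rule imageI)
    then obtain t where t: "x + s = y + t" "t \<in> S"
      by (rule imageE)
    have "x - y + s = (x + s) - y"
      by (rule diff_add_eq)
    also have "\<dots> = t"
      unfolding t(1) by (rule add_diff_cancel_left')
    finally show ?thesis
      using t(2) by (rule ssubst)
  qed
  then show "x = y"
    using assms[of "x - y"] by simp
qed

section \<open>Configurations and their realizations\<close>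

lemma card_incidences:
  assumes "configuration n k S"
  shows "card (incidences S) = n * k"
proof -
  have S: "finite (points S)" "finite (lines S)" "incidences S \<subseteq> points S \<times> lines S"
      "card (points S) = n" "\<And>q. q \<in> points S \<Longrightarrow> card {l \<in> lines S. (q, l) \<in> incidences S} = k"
    using assms by (auto simp: configuration_def incidence_structure_def)
  have "incidences S = (SIGMA q:points S. {l \<in> lines S. (q, l) \<in> incidences S})"
    using S(3) by auto
  then have "card (incidences S) = card (SIGMA q:points S. {l \<in> lines S. (q, l) \<in> incidences S})"
    by (rule arg_cong)
  also have "\<dots> = (\<Sum>q\<in>points S. card {l \<in> lines S. (q, l) \<in> incidences S})"
    using S(1,2) by (intro card_SigmaI) auto
  also have "\<dots> = n * k"
    using S(4,5) by simp
  finally show ?thesis .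
qed

text \<open>Two points with the same image would be incident with the same \<open>k\<close> lines,
  and \<open>k\<close> is at least 2, yet they share at most one line. The dual argument separates
  the lines.\<close>

lemma geometric_realizationI:
  assumes S: "configuration n k S" and "2 \<le> k"
    and line: "\<And>l. l \<in> lines S \<Longrightarrow> straight_line (L l)"
    and inc: "\<And>q l. q \<in> points S \<Longrightarrow> l \<in> lines S \<Longrightarrow> p q \<in> L l \<longleftrightarrow> (q, l) \<in> incidences S"
  shows "geometric_realization S p L"
proof -
  have "q = q'" if q: "q \<in> points S" "q' \<in> points S" "p q = p q'" for q q'
  proof (rule ccontr)
    assume "q \<noteq> q'"
    then have "card {l \<in> lines S. (q, l) \<in> incidences S \<and> (q', l) \<in> incidences S} \<le> 1"
      using q S by (simp add: configuration_def incidence_structure_def)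
    also have "{l \<in> lines S. (q, l) \<in> incidences S \<and> (q', l) \<in> incidences S}
        = {l \<in> lines S. (q, l) \<in> incidences S}"
      using q inc by (auto simp flip: inc)
    also have "card \<dots> = k"
      using q S by (simp add: configuration_def)
    finally show False
      using \<open>2 \<le> k\<close> by simp
  qed
  moreover have "l = l'" if l: "l \<in> lines S" "l' \<in> lines S" "L l = L l'" for l l'
  proof (rule ccontr)
    assume "l \<noteq> l'"
    then have "card {q \<in> points S. (q, l) \<in> incidences S \<and> (q, l') \<in> incidences S} \<le> 1"
      using l S by (simp add: configuration_def incidence_structure_def)
    also have "{q \<in> points S. (q, l) \<in> incidences S \<and> (q, l') \<in> incidences S}
        = {q \<in> points S. (q, l) \<in> incidences S}"
      using l inc by (auto simp flip: inc)
    also have "card \<dots> = k"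
      using l S by (simp add: configuration_def)
    finally show False
      using \<open>2 \<le> k\<close> by simp
  qed
  ultimately show ?thesis
    using line inc by (auto simp: geometric_realization_def inj_on_def)
qed

context
  fixes n k S p L
  assumes S: "configuration n k S" and real: "geometric_realization S p L"
begin

lemma realization_points_on_line:
  assumes "l \<in> lines S"
  shows "card {x \<in> p ` points S. x \<in> L l} = k"
proof -
  have "{x \<in> p ` points S. x \<in> L l} = p ` {q \<in> points S. (q, l) \<in> incidences S}"
    using real assms by (auto simp: geometric_realization_def)
  moreover have "inj_on p {q \<in> points S. (q, l) \<in> incidences S}"
    using real by (auto simp: geometric_realization_def inj_on_def)
  ultimately show ?thesis
    using S assms by (simp add: card_image configuration_def)
qed

lemma realization_lines_through_point:
  assumes "q \<in> points S"
  shows "card {K \<in> L ` lines S. p q \<in> K} = k"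
proof -
  have "{K \<in> L ` lines S. p q \<in> K} = L ` {l \<in> lines S. (q, l) \<in> incidences S}"
    using real assms by (auto simp: geometric_realization_def)
  moreover have "inj_on L {l \<in> lines S. (q, l) \<in> incidences S}"
    using real by (auto simp: geometric_realization_def inj_on_def)
  ultimately show ?thesis
    using S assms by (simp add: card_image configuration_def)
qed

text \<open>Injectivity of \<open>p\<close> and \<open>L\<close> makes \<open>map_prod p L\<close> a
  bijection from the incidences of \<open>S\<close> to those in the plane.\<close>

lemma card_realization_incidences:
  "card {(x, K). x \<in> p ` points S \<and> K \<in> L ` lines S \<and> x \<in> K} = n * k"
proof -
  have sub: "incidences S \<subseteq> points S \<times> lines S"
    using S by (simp add: configuration_def incidence_structure_def)
  have "{(x, K). x \<in> p ` points S \<and> K \<in> L ` lines S \<and> x \<in> K} = map_prod p L ` incidences S"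
    using real sub by (fastforce simp: geometric_realization_def)
  moreover have "inj_on (map_prod p L) (incidences S)"
    using real by (intro inj_on_subset[OF map_prod_inj_on sub]) (auto simp: geometric_realization_def)
  ultimately show ?thesis
    using card_incidences[OF S] by (simp add: card_image)
qed

lemma realization_edges:
  "{{q, l} | q l. q \<in> points S \<and> l \<in> lines S \<and> p q \<in> L l} = edges (levi_graph S)"
proof -
  have "incidences S \<subseteq> points S \<times> lines S"
    using S by (simp add: configuration_def incidence_structure_def)
  then have "q \<in> points S \<and> l \<in> lines S \<and> p q \<in> L l \<longleftrightarrow> (q, l) \<in> incidences S" for q l
    using real by (auto simp: geometric_realization_def)
  then show ?thesis
    by (simp add: levi_graph_def)
qed

end

section \<open>The configuration of triads\<close>

text \<open>Around the circle of residues the gaps of \<open>{0, 4, 7}\<close> are 4, 3, 5. They are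
  pairwise distinct, so only the zero translation preserves the set.\<close>

lemma inj_major_triad: "inj major_triad"
proof -
  have "\<forall>d::12. (\<forall>s\<in>{0, 4, 7}. d + s \<in> {0, 4, 7}) \<longrightarrow> d = 0"
    unfolding all_12 by simp
  then have "inj (\<lambda>x::12. (+) x ` {0, 4, 7})"
    by (intro inj_translates) blast
  then show ?thesis
    by (simp add: major_triad_def[abs_def])
qed

lemma inj_minor_triad: "inj minor_triad"
proof -
  have "\<forall>d::12. (\<forall>s\<in>{0, 3, 7}. d + s \<in> {0, 3, 7}) \<longrightarrow> d = 0"
    unfolding all_12 by simp
  then have "inj (\<lambda>x::12. (+) x ` {0, 3, 7})"
    by (intro inj_translates) blast
  then show ?thesis
    by (simp add: minor_triad_def[abs_def])
qed

text \<open>Both kinds of triad have gaps 3, 4, 5, but in opposite cyclic orders. Translating the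
  major root to 0 leaves twelve cases, and testing inclusion reduces each to membership
  checks.\<close>

lemma major_triad_neq_minor_triad: "major_triad x \<noteq> minor_triad y"
proof
  assume "major_triad x = minor_triad y"
  then have "(+) (- x) ` major_triad x = (+) (- x) ` minor_triad y"
    by simp
  then have "{0, 4, 7} = minor_triad (y - x)"
    by (simp add: major_triad_def minor_triad_def algebra_simps)
  moreover have "\<forall>d. \<not> minor_triad d \<subseteq> {0, 4, 7}"
    unfolding all_12 by (simp add: minor_triad_def)
  ultimately show False
    by blast
qed

text \<open>Translation by \<open>- x\<close> shows that only the difference of the roots matters.
  The values 0, 4, 9 are the parallel minor, the leading-tone exchange and the relative
  minor.\<close>

lemma card_triads_Int:
  "card (major_triad x \<inter> minor_triad y) = 2 \<longleftrightarrow> y - x \<in> {0, 4, 9}"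
proof -
  have "major_triad x \<inter> minor_triad y = (+) x ` (major_triad 0 \<inter> minor_triad (y - x))"
    unfolding image_Int[OF inj_on_add]
    by (simp add: major_triad_def minor_triad_def algebra_simps)
  then have "card (major_triad x \<inter> minor_triad y) = card (major_triad 0 \<inter> minor_triad (y - x))"
    by (simp add: card_image)
  moreover have "\<forall>d. card (major_triad 0 \<inter> minor_triad d) = 2 \<longleftrightarrow> d \<in> {0, 4, 9}"
    unfolding all_12 by (simp add: major_triad_def minor_triad_def)
  ultimately show ?thesis
    by simp
qed

lemma triad_structure_simps:
  "points triad_structure = range major_triad"
  "lines triad_structure = range minor_triad"
  "(major_triad x, minor_triad y) \<in> incidences triad_structure \<longleftrightarrow> y - x \<in> {0, 4, 9}"
  unfolding card_triads_Int[symmetric]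
  by (auto simp: triad_structure_def major_triads_def minor_triads_def)

text \<open>The nonzero differences within \<open>{0, 4, 9}\<close> are 3, 4, 5, 7, 8, 9, each
  arising once. This is what bounds common points and common lines by one.\<close>

lemma triad_differences:
  fixes a b c e :: 12
  assumes "a \<in> {0, 4, 9}" "b \<in> {0, 4, 9}" "c \<in> {0, 4, 9}" "e \<in> {0, 4, 9}"
    and "a - b = c - e" and "a \<noteq> b"
  shows "a = c"
proof -
  have "\<forall>a\<in>{0, 4, 9::12}. \<forall>b\<in>{0, 4, 9}. \<forall>c\<in>{0, 4, 9}. \<forall>e\<in>{0, 4, 9}.
      a - b = c - e \<longrightarrow> a \<noteq> b \<longrightarrow> a = c"
    by simp
  then show ?thesis
    using assms by blast
qed

lemma configuration_triad_structure: "configuration 12 3 triad_structure"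
proof -
  let ?I = "incidences triad_structure"
  have sets: "{q \<in> range major_triad. (q, minor_triad y) \<in> ?I} = major_triad ` {x. y - x \<in> {0, 4, 9}}"
     "{l \<in> range minor_triad. (major_triad x, l) \<in> ?I} = minor_triad ` {y. y - x \<in> {0, 4, 9}}"
     for x y
    \<comment> \<open>Without \<open>insert_iff\<close>, membership in \<open>{0, 4, 9}\<close>
      stays atomic instead of splitting into cases.\<close>
    by (auto simp: triad_structure_simps(3) simp del: insert_iff)
  have "{x. y - x \<in> {0, 4, 9}} = (\<lambda>d. y - d) ` {0, 4, 9}" for y :: 12
    by (force simp: image_iff algebra_simps)
  then have "card {x. y - x \<in> {0, 4, 9}} = 3" for y :: 12
    by simp
  then have on_line: "card {q \<in> range major_triad. (q, minor_triad y) \<in> ?I} = 3" for y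
    unfolding sets by (subst card_image) (auto intro: inj_on_subset[OF inj_major_triad])
  have "{y. y - x \<in> {0, 4, 9}} = (+) x ` {0, 4, 9}" for x :: 12
    by (force simp: image_iff algebra_simps)
  then have "card {y. y - x \<in> {0, 4, 9}} = 3" for x :: 12
    by simp
  then have through: "card {l \<in> range minor_triad. (major_triad x, l) \<in> ?I} = 3" for x
    unfolding sets by (subst card_image) (auto intro: inj_on_subset[OF inj_minor_triad])
  have lines_meet: "card {q \<in> range major_triad. (q, minor_triad y) \<in> ?I \<and> (q, minor_triad y') \<in> ?I} \<le> 1"
    if "y \<noteq> y'" for y y'
  proof -
    let ?A = "{x. y - x \<in> {0, 4, 9} \<and> y' - x \<in> {0, 4, 9}}"
    \<comment> \<open>For every common point, \<open>(y - x) - (y' - x)\<close> is the fixed nonzero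
      value \<open>y - y'\<close>, which determines \<open>y - x\<close> and hence
      \<open>x\<close>.\<close>
    have "x = x'" if "x \<in> ?A" "x' \<in> ?A" for x x'
      using that triad_differences[of "y - x" "y' - x" "y - x'" "y' - x'"] \<open>y \<noteq> y'\<close>
      by (simp del: insert_iff)
    then have "card ?A \<le> 1"
      unfolding One_nat_def by (subst card_le_Suc0_iff_eq[OF finite]) blast
    moreover have "{q \<in> range major_triad. (q, minor_triad y) \<in> ?I \<and> (q, minor_triad y') \<in> ?I}
        = major_triad ` ?A"
      by (auto simp: triad_structure_simps(3) simp del: insert_iff)
    ultimately show ?thesis
      using card_image_le[of ?A major_triad] by (simp del: insert_iff)
  qed
  have points_join: "card {l \<in> range minor_triad. (major_triad x, l) \<in> ?I \<and> (major_triad x', l) \<in> ?I} \<le> 1"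
    if "x \<noteq> x'" for x x'
  proof -
    let ?A = "{y. y - x \<in> {0, 4, 9} \<and> y - x' \<in> {0, 4, 9}}"
    have "y = y'" if "y \<in> ?A" "y' \<in> ?A" for y y'
      using that triad_differences[of "y - x" "y - x'" "y' - x" "y' - x'"] \<open>x \<noteq> x'\<close>
      by (simp del: insert_iff)
    then have "card ?A \<le> 1"
      unfolding One_nat_def by (subst card_le_Suc0_iff_eq[OF finite]) blast
    moreover have "{l \<in> range minor_triad. (major_triad x, l) \<in> ?I \<and> (major_triad x', l) \<in> ?I}
        = minor_triad ` ?A"
      by (auto simp: triad_structure_simps(3) simp del: insert_iff)
    ultimately show ?thesis
      using card_image_le[of ?A minor_triad] by (simp del: insert_iff)
  qed
  have "?I \<subseteq> range major_triad \<times> range minor_triad"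
    by (auto simp: triad_structure_def major_triads_def minor_triads_def)
  moreover have "range major_triad \<inter> range minor_triad = {}"
    using major_triad_neq_minor_triad by blast
  moreover have "card (range major_triad) = 12" "card (range minor_triad) = 12"
    by (simp_all add: card_image inj_major_triad inj_minor_triad)
  ultimately show ?thesis
    unfolding configuration_def incidence_structure_def triad_structure_simps(1,2)
    using on_line through lines_meet points_join
    by (simp add: inj_eq[OF inj_major_triad] inj_eq[OF inj_minor_triad])
qed

text \<open>Incidence depends only on the difference of the roots, so negating the roots is a duality.\<close>

lemma self_dual_triad_structure: "self_dual triad_structure"
proof -
  let ?f = "\<lambda>M. minor_triad (- inv major_triad M)"
  let ?g = "\<lambda>m. major_triad (- inv minor_triad m)"
  have "bij_betw ?f (range major_triad) (range minor_triad)"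
    by (rule bij_betw_byWitness[where f' = ?g]) (auto simp: inj_major_triad inj_minor_triad)
  moreover have "bij_betw ?g (range minor_triad) (range major_triad)"
    by (rule bij_betw_byWitness[where f' = ?f]) (auto simp: inj_major_triad inj_minor_triad)
  ultimately have "isomorphism ?f ?g triad_structure (dual_structure triad_structure)"
    by (auto simp: isomorphism_def dual_structure_def triad_structure_simps
        inj_major_triad inj_minor_triad simp del: insert_iff)
  then show ?thesis
    by (auto simp: self_dual_def isomorphic_def)
qed

section \<open>The configuration D222\<close>

text \<open>Naming the parametrization lets \<open>inv D222_line\<close> recover the index of a
  line.\<close>

definition D222_line :: "12 \<Rightarrow> 12 set" where
  "D222_line i = {i, i + 1, i + 4}"

lemma mem_D222_line_iff: "x \<in> D222_line i \<longleftrightarrow> x - i \<in> {0, 1, 4}"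
  by (auto simp: D222_line_def algebra_simps)

lemma inj_D222_line: "inj D222_line"
proof -
  have "\<forall>d::12. (\<forall>s\<in>{0, 1, 4}. d + s \<in> {0, 1, 4}) \<longrightarrow> d = 0"
    unfolding all_12 by simp
  then have "inj (\<lambda>x::12. (+) x ` {0, 1, 4})"
    by (intro inj_translates) blast
  then show ?thesis
    by (simp add: D222_line_def[abs_def])
qed

lemma D222_simps:
  "points D222 = range Inl"
  "lines D222 = range (\<lambda>i. Inr (D222_line i))"
  "(Inl x, Inr (D222_line i)) \<in> incidences D222 \<longleftrightarrow> x \<in> D222_line i"
  by (auto simp: D222_def D222_lines_def D222_line_def)

text \<open>The affine substitution is found by matching difference sets:
  \<open>7 * {0, -4, -9} - 8 = {4, 0, 1}\<close> modulo 12.\<close>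

lemma isomorphic_triad_structure_D222: "isomorphic triad_structure D222"
proof -
  let ?f = "\<lambda>M. Inl (7 * inv major_triad M) :: 12 + 12 set"
  let ?g = "\<lambda>m. Inr (D222_line (7 * inv minor_triad m + 8)) :: 12 + 12 set"
  \<comment> \<open>The round trip on line indices is
    \<open>7 * (7 * (j - 8)) + 8 = 49 * j - 384\<close>, and \<open>384 = 32 * 12\<close>.\<close>
  have eq0: "384 = (0 :: 12)"
    by simp
  have "bij_betw ?f (range major_triad) (range Inl)"
    by (rule bij_betw_byWitness[where f' = "\<lambda>q. major_triad (7 * projl q)"])
      (auto simp: inj_major_triad mult_49)
  moreover have "bij_betw ?g (range minor_triad) (range (\<lambda>i. Inr (D222_line i)))"
    by (rule bij_betw_byWitness[where f' = "\<lambda>l. minor_triad (7 * (inv D222_line (projr l) - 8))"])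
      (auto simp: inj_minor_triad inj_D222_line mult_49 eq0)
  moreover have "7 * x \<in> D222_line (7 * y + 8) \<longleftrightarrow> y - x \<in> {0, 4, 9}" for x y :: 12
  proof -
    have "\<forall>d::12. - (7 * d) - 8 \<in> {0, 1, 4} \<longleftrightarrow> d \<in> {0, 4, 9}"
      unfolding all_12 by simp
    then have "- (7 * (y - x)) - 8 \<in> {0, 1, 4} \<longleftrightarrow> y - x \<in> {0, 4, 9}"
      by blast
    then show ?thesis
      unfolding mem_D222_line_iff by (simp add: algebra_simps)
  qed
  ultimately have "isomorphism ?f ?g triad_structure D222"
    by (auto simp: isomorphism_def triad_structure_simps D222_simps
        inj_major_triad inj_minor_triad simp del: insert_iff)
  then show ?thesis
    by (auto simp: isomorphic_def)
qed

section \<open>Realization in the plane\<close>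

text \<open>The equation says that the determinant of \<open>b - a\<close> and \<open>v - a\<close>
  vanishes, which turns membership in a line into arithmetic on coordinates.\<close>

lemma mem_affine_hull_2_iff:
  fixes a b v :: "real^2"
  assumes "a \<noteq> b"
  shows "v \<in> affine hull {a, b} \<longleftrightarrow> (b$1 - a$1) * (v$2 - a$2) = (b$2 - a$2) * (v$1 - a$1)"
proof
  assume "v \<in> affine hull {a, b}"
  then obtain u where "v = a + u *\<^sub>R (b - a)"
    by (auto simp: affine_hull_2_alt)
  then show "(b$1 - a$1) * (v$2 - a$2) = (b$2 - a$2) * (v$1 - a$1)"
    by simp
next
  assume eq: "(b$1 - a$1) * (v$2 - a$2) = (b$2 - a$2) * (v$1 - a$1)"
  \<comment> \<open>The parameter \<open>u\<close> comes from dividing in a coordinate where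
    \<open>a\<close> and \<open>b\<close> differ; \<open>eq\<close> then settles the other
    coordinate.\<close>
  consider "b$1 \<noteq> a$1" | "b$2 \<noteq> a$2"
    using assms by (auto simp: vec_eq_iff forall_2)
  then obtain u where "u * (b$1 - a$1) = v$1 - a$1" "u * (b$2 - a$2) = v$2 - a$2"
  proof cases
    case 1
    then show ?thesis
      using eq by (intro that[of "(v$1 - a$1) / (b$1 - a$1)"]) (simp_all add: divide_eq_eq mult.commute)
  next
    case 2
    then show ?thesis
      using eq by (intro that[of "(v$2 - a$2) / (b$2 - a$2)"]) (simp_all add: divide_eq_eq mult.commute)
  qed
  then have "v = a + u *\<^sub>R (b - a)"
    by (simp add: vec_eq_iff forall_2)
  then show "v \<in> affine hull {a, b}"
    by (auto simp: affine_hull_2_alt)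
qed

text \<open>A solution with small integer coordinates, found by computer search.\<close>

definition D222_coords :: "12 \<Rightarrow> int \<times> int" where
  "D222_coords i =
     (if i = 0 then (6, 12) else if i = 1 then (6, 9) else if i = 2 then (8, 5)
      else if i = 3 then (5, 8) else if i = 4 then (6, 6) else if i = 5 then (7, 7)
      else if i = 6 then (9, 4) else if i = 7 then (9, 0) else if i = 8 then (0, 0)
      else if i = 9 then (5, 10) else if i = 10 then (9, 6) else (3, 0))"

lemma D222_coords_neq: "D222_coords i \<noteq> D222_coords (i + 1)"
proof -
  have "\<forall>i. D222_coords i \<noteq> D222_coords (i + 1)"
    unfolding all_12 by (simp add: D222_coords_def)
  then show ?thesis ..
qed

text \<open>Line \<open>i\<close> is spanned by points \<open>i\<close> and \<open>i + 1\<close>.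
  All 144 pairs are tested, so unwanted incidences are excluded as well.\<close>

lemma D222_coords_collinear_iff:
  "(fst (D222_coords (i + 1)) - fst (D222_coords i)) * (snd (D222_coords j) - snd (D222_coords i))
     = (snd (D222_coords (i + 1)) - snd (D222_coords i)) * (fst (D222_coords j) - fst (D222_coords i))
   \<longleftrightarrow> j \<in> D222_line i"
proof -
  have "\<forall>i j.
     (fst (D222_coords (i + 1)) - fst (D222_coords i)) * (snd (D222_coords j) - snd (D222_coords i))
     = (snd (D222_coords (i + 1)) - snd (D222_coords i)) * (fst (D222_coords j) - fst (D222_coords i))
     \<longleftrightarrow> j \<in> D222_line i"
    unfolding all_12 by (simp add: D222_coords_def D222_line_def)
  then show ?thesis
    by blast
qed

definition D222_point :: "12 \<Rightarrow> real^2" where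
  "D222_point i = vector [of_int (fst (D222_coords i)), of_int (snd (D222_coords i))]"

lemma D222_point_neq: "D222_point i \<noteq> D222_point (i + 1)"
  using D222_coords_neq[of i] by (auto simp: D222_point_def vec_eq_iff forall_2 prod_eq_iff)

text \<open>Both sides of the determinant equation are casts of integers, so injectivity of the cast
  transfers the integer test to the reals.\<close>

lemma D222_point_mem_iff:
  "D222_point j \<in> affine hull {D222_point i, D222_point (i + 1)} \<longleftrightarrow> j \<in> D222_line i"
  unfolding mem_affine_hull_2_iff[OF D222_point_neq] D222_coords_collinear_iff[symmetric]
  by (simp add: D222_point_def flip: of_int_diff of_int_mult)

text \<open>The hull of all three points depends only on the line as a set, not on a chosen index;
  the third point is redundant because it is collinear with the other two.\<close>

lemma affine_hull_D222_line:
  "affine hull (D222_point ` D222_line i) = affine hull {D222_point i, D222_point (i + 1)}"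
proof -
  have "D222_point (i + 4) \<in> affine hull {D222_point i, D222_point (i + 1)}"
    unfolding D222_point_mem_iff by (simp add: D222_line_def)
  then have "affine hull insert (D222_point (i + 4)) {D222_point i, D222_point (i + 1)}
      = affine hull {D222_point i, D222_point (i + 1)}"
    by (rule hull_redundant)
  then show ?thesis
    by (simp add: D222_line_def insert_commute)
qed

lemma straight_line_D222:
  assumes "l \<in> lines D222"
  shows "straight_line (affine hull (D222_point ` projr l))"
proof -
  obtain i where "l = Inr (D222_line i)"
    using assms by (auto simp: D222_simps)
  then have "affine hull (D222_point ` projr l) = affine hull {D222_point i, D222_point (i + 1)}"
    by (simp add: affine_hull_D222_line)
  then show ?thesis
    using D222_point_neq unfolding straight_line_def by blast
qed

lemma D222_incidence_iff:
  assumes "q \<in> points D222" "l \<in> lines D222"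
  shows "D222_point (projl q) \<in> affine hull (D222_point ` projr l) \<longleftrightarrow> (q, l) \<in> incidences D222"
proof -
  obtain j i where "q = Inl j" "l = Inr (D222_line i)"
    using assms by (auto simp: D222_simps)
  then show ?thesis
    by (simp add: D222_simps affine_hull_D222_line D222_point_mem_iff)
qed

text \<open>The planar picture of D222 is pulled back along the isomorphism.\<close>

lemma triad_structure_realization:
  obtains p L where "geometric_realization triad_structure p L"
proof -
  let ?T = triad_structure
  obtain f g where iso: "isomorphism f g ?T D222"
    using isomorphic_triad_structure_D222 by (auto simp: isomorphic_def)
  have f: "f q \<in> points D222" if "q \<in> points ?T" for q
    using iso that by (auto simp: isomorphism_def bij_betw_def)
  have g: "g l \<in> lines D222" if "l \<in> lines ?T" for l
    using iso that by (auto simp: isomorphism_def bij_betw_def)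
  have "geometric_realization ?T (\<lambda>M. D222_point (projl (f M)))
      (\<lambda>m. affine hull (D222_point ` projr (g m)))"
    using configuration_triad_structure
  proof (rule geometric_realizationI)
    fix q l
    assume "q \<in> points ?T" "l \<in> lines ?T"
    then show "D222_point (projl (f q)) \<in> affine hull (D222_point ` projr (g l))
        \<longleftrightarrow> (q, l) \<in> incidences ?T"
      using iso by (simp add: D222_incidence_iff f g isomorphism_def)
  qed (simp_all add: g straight_line_D222)
  then show thesis
    by (rule that)
qed

theorem proposition2:
  "configuration 12 3 triad_structure \<and>
   self_dual triad_structure \<and>
   isomorphic triad_structure D222 \<and>
   (\<exists>(p :: pitch_class set \<Rightarrow> real^2) (L :: pitch_class set \<Rightarrow> (real^2) set).
      geometric_realization triad_structure p L \<and>
      (\<forall>m\<in>minor_triads. card {x \<in> p ` major_triads. x \<in> L m} = 3) \<and>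
      (\<forall>M\<in>major_triads. card {K \<in> L ` minor_triads. p M \<in> K} = 3) \<and>
      card {(x, K). x \<in> p ` major_triads \<and> K \<in> L ` minor_triads \<and> x \<in> K} = 36 \<and>
      {{M, m} | M m. M \<in> major_triads \<and> m \<in> minor_triads \<and> p M \<in> L m}
        = edges (levi_graph triad_structure))"
proof -
  obtain p L where real: "geometric_realization triad_structure p L"
    by (rule triad_structure_realization)
  have sets: "major_triads = points triad_structure" "minor_triads = lines triad_structure"
    by (simp_all add: triad_structure_def)
  note conf = configuration_triad_structure
  show ?thesis
    unfolding sets
    using conf self_dual_triad_structure isomorphic_triad_structure_D222 real
      realization_points_on_line[OF conf real] realization_lines_through_point[OF conf real]
      card_realization_incidences[OF conf real] realization_edges[OF conf real]
    by (intro conjI exI[of _ p] exI[of _ L]) auto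
qed

end
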